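(* A convex body $K\subset\mathbb{R}^n$ is outer additive if and only if it is a simplex (i.e. an $n$-dimensional simplex).
   Context: A convex body is a compact convex set with nonempty interior. For compact convex $K,L\subset\mathbb{R}^n$, $\lambda_K(L):=\inf\{\lambda\ge 0:\exists x\in\mathbb{R}^n,\ L\subset x+\lambda K\}$. A convex body $K\subset\mathbb{R}^n$ is outer additive if for all nonempty compact convex sets $L_1,L_2\subset\mathbb{R}^n$, $$\lambda_K(L_1+L_2)=\lambda_K(L_1)+\lambda_K(L_2),$$ where $L_1+L_2=\{a+b:a\in L_1,b\in L_2\}$ is the Minkowski sum. *)

theory Defs
  imports "HOL-Analysis.Analysis"
begin

definition convex_body :: "'a::euclidean_space set \<Rightarrow> bool" where
  "convex_body K \<longleftrightarrow> compact K \<and> convex K \<and> interior K \<noteq> {}"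

(* The infimum is taken in the extended reals, so that it is infinity when no
   homothetic copy of K covers L; if K is a convex body and L is bounded, it is finite. *)
definition circumscribing_factor :: "'a::euclidean_space set \<Rightarrow> 'a set \<Rightarrow> ereal" where
  "circumscribing_factor K L =
     Inf {ereal r | r. 0 \<le> r \<and> (\<exists>x. L \<subseteq> (+) x ` ((*\<^sub>R) r ` K))}"

(* The sum of sets is the Minkowski sum of HOL-Library.Set_Algebras. *)
definition outer_additive :: "'a::euclidean_space set \<Rightarrow> bool" where
  "outer_additive K \<longleftrightarrow>
     (\<forall>L1 L2. L1 \<noteq> {} \<and> compact L1 \<and> convex L1 \<and> L2 \<noteq> {} \<and> compact L2 \<and> convex L2 \<longrightarrow>
        circumscribing_factor K (L1 + L2) =
          circumscribing_factor K L1 + circumscribing_factor K L2)"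

end

theory Submission
  imports Defs
begin

text \<open>
  Let \<open>C\<close> be the cone in \<open>'a \<times> real\<close> spanned by \<open>K \<times> {1}\<close>. Every point \<open>p = (x, r)\<close> of height
  \<open>r \<ge> 0\<close> stands for the homothet \<open>r K - x\<close>. With this parametrization Minkowski addition of
  homothets is addition of points, inclusion of homothets is the order of the cone \<open>C\<close>, and the
  circumscribing factor of \<open>L\<close> is the least height of a point whose homothet contains \<open>L\<close>.

  A simplex is outer additive because the points \<open>(v, 1)\<close>, for \<open>v\<close> a vertex, form a basis of
  \<open>'a \<times> real\<close> and \<open>C\<close> is the positive orthant of that basis. So \<open>L\<close> lies in the homothet of \<open>p\<close> iff
  each coordinate of \<open>p\<close> is at least a certain value of the support function of \<open>L\<close>. There is a
  coordinatewise least such \<open>p\<close>, and its height is a sum of values of the support function, which is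
  additive in \<open>L\<close> (\<open>circumscribing_factor_simplex\<close>).

  Conversely, let \<open>K\<close> be outer additive. Convex sets satisfy
  \<open>convex hull (A \<union> B) + A \<inter> B \<subseteq> A + B\<close>. If \<open>A\<close> is a smallest homothet containing \<open>L\<close> and \<open>B\<close> is any
  homothet containing \<open>L\<close>, then \<open>A \<inter> B\<close> has the same factor as \<open>A\<close>, and additivity shows that the
  convex hull of \<open>A \<union> B\<close> has no larger factor than \<open>B\<close>. This forces \<open>A \<subseteq> B\<close>
  (\<open>minimal_homothet_least\<close>). So the order of \<open>C\<close> has the interpolation property
  (\<open>homothet_interpolation\<close>), as in the theory of Choquet simplices. Distinct extreme points of
  \<open>K\<close> generate distinct extreme rays of \<open>C\<close>, and interpolation prevents a generator of one ray
  from lying below a nonnegative combination of the others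
  (\<open>extreme_generator_disjoint\<close>). An affine dependence between extreme points would produce exactly
  such a relation, so the extreme points are affinely independent, and by the
  Krein--Milman--Minkowski theorem \<open>K\<close> is their convex hull.
\<close>

section \<open>Homothets and the cone over a convex body\<close>

definition cone_over :: "'a::euclidean_space set \<Rightarrow> ('a \<times> real) set" where
  "cone_over K = conic hull (K \<times> {1})"

text \<open>
  For \<open>p = (x, r)\<close> this is \<open>r K - x\<close> if \<open>r \<ge> 0\<close>, and empty otherwise. The centre enters with a
  negative sign so that larger points in the order of the cone give larger sets.
\<close>

definition homothet :: "'a::euclidean_space set \<Rightarrow> 'a \<times> real \<Rightarrow> 'a set" where
  "homothet K p = {y. (y, 0) + p \<in> cone_over K}"

lemma mem_cone_over: "(x, r) \<in> cone_over K \<longleftrightarrow> 0 \<le> r \<and> x \<in> (*\<^sub>R) r ` K"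
  by (auto simp: cone_over_def conic_hull_explicit)

lemma snd_cone_over_nonneg: "p \<in> cone_over K \<Longrightarrow> 0 \<le> snd p"
  by (cases p) (simp add: mem_cone_over)

text \<open>
  The cone is pointed: this is what makes its order antisymmetric.
\<close>

lemma cone_over_zero_height: "p \<in> cone_over K \<Longrightarrow> snd p = 0 \<Longrightarrow> p = 0"
  by (cases p) (auto simp: mem_cone_over zero_prod_def)

lemma cone_over_generator: "v \<in> K \<Longrightarrow> 0 \<le> a \<Longrightarrow> a *\<^sub>R (v, 1) \<in> cone_over K"
  by (auto simp: mem_cone_over)

lemma cone_over_add:
  assumes "convex K" "p \<in> cone_over K" "q \<in> cone_over K"
  shows "p + q \<in> cone_over K"
proof -
  have "convex (cone_over K)"
    unfolding cone_over_def by (intro convex_conic_hull convex_Times assms convex_singleton)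
  then have "(1/2) *\<^sub>R p + (1/2) *\<^sub>R q \<in> cone_over K"
    using assms by (intro convexD) auto
  then have "2 *\<^sub>R ((1/2) *\<^sub>R p + (1/2) *\<^sub>R q) \<in> cone_over K"
    unfolding cone_over_def by (intro conicD[OF conic_conic_hull]) auto
  then show ?thesis by (simp add: scaleR_right_distrib)
qed

lemma cone_over_sum:
  assumes "convex K" "K \<noteq> {}" "\<And>i. i \<in> I \<Longrightarrow> p i \<in> cone_over K"
  shows "(\<Sum>i\<in>I. p i) \<in> cone_over K"
proof -
  have "0 \<in> cone_over K" using assms(2) by (simp add: cone_over_def)
  then show ?thesis
    using assms(3) by (induction I rule: infinite_finite_induct) (auto intro: cone_over_add[OF assms(1)])
qed

lemma homothet_eq_image:
  assumes "0 \<le> r"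
  shows "homothet K (x, r) = (+) (- x) ` ((*\<^sub>R) r ` K)"
proof -
  have "y = - x + r *\<^sub>R k \<longleftrightarrow> y + x = r *\<^sub>R k" for y k by (auto simp: algebra_simps)
  then show ?thesis using assms by (auto simp: homothet_def mem_cone_over image_iff)
qed

lemma homothet_nonempty_imp: "y \<in> homothet K p \<Longrightarrow> 0 \<le> snd p"
  by (auto simp: homothet_def dest: snd_cone_over_nonneg)

text \<open>
  The side condition \<open>r \<ge> 0\<close> becomes automatic, because a homothet of negative height is empty and
  cannot contain a nonempty set.
\<close>

lemma circumscribing_factor_eq:
  assumes "L \<noteq> {}"
  shows "circumscribing_factor K L = Inf ((\<lambda>p. ereal (snd p)) ` {p. L \<subseteq> homothet K p})"
proof -
  have "{ereal r |r. 0 \<le> r \<and> (\<exists>x. L \<subseteq> (+) x ` ((*\<^sub>R) r ` K))}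
      = (\<lambda>p. ereal (snd p)) ` {p. L \<subseteq> homothet K p}" (is "?A = ?B")
  proof
    show "?A \<subseteq> ?B"
    proof
      fix e assume "e \<in> ?A"
      then obtain r x where r: "e = ereal r" "0 \<le> r" "L \<subseteq> (+) x ` ((*\<^sub>R) r ` K)" by auto
      then have "L \<subseteq> homothet K (- x, r)" by (simp add: homothet_eq_image)
      then show "e \<in> ?B" using r(1) by force
    qed
    show "?B \<subseteq> ?A"
    proof
      fix e assume "e \<in> ?B"
      then obtain x r where p: "e = ereal r" "L \<subseteq> homothet K (x, r)" by auto
      have "0 \<le> r" using p(2) assms homothet_nonempty_imp[of _ K "(x, r)"] by auto
      then have "L \<subseteq> (+) (- x) ` ((*\<^sub>R) r ` K)" using p(2) by (simp only: homothet_eq_image)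
      with p(1) \<open>0 \<le> r\<close> show "e \<in> ?A" by blast
    qed
  qed
  then show ?thesis by (simp add: circumscribing_factor_def)
qed

lemma circumscribing_factor_le:
  "L \<noteq> {} \<Longrightarrow> L \<subseteq> homothet K p \<Longrightarrow> circumscribing_factor K L \<le> ereal (snd p)"
  by (auto simp: circumscribing_factor_eq intro: Inf_lower)

lemma circumscribing_factor_mono:
  "L \<subseteq> M \<Longrightarrow> circumscribing_factor K L \<le> circumscribing_factor K M"
  unfolding circumscribing_factor_def by (intro Inf_superset_mono) blast

text \<open>
  If a point \<open>a \<in> A\<close> were strictly separated from \<open>C\<close> by a linear functional, then adding to \<open>a\<close> a
  point of \<open>B\<close> at which that functional is minimal would leave \<open>C + B\<close>.
\<close>

lemma minkowski_cancel:
  fixes A B C :: "'a::euclidean_space set"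
  assumes "compact B" "B \<noteq> {}" "closed C" "convex C" "A + B \<subseteq> C + B"
  shows "A \<subseteq> C"
proof (rule subsetI, rule ccontr)
  fix a assume a: "a \<in> A" "a \<notin> C"
  obtain u \<beta> where u: "u \<bullet> a < \<beta>" "\<And>c. c \<in> C \<Longrightarrow> \<beta> < u \<bullet> c"
    using separating_hyperplane_closed_point[OF assms(4,3) a(2)] by auto
  have "continuous_on B (\<lambda>b. u \<bullet> b)" by (intro continuous_intros)
  then obtain b where b: "b \<in> B" "\<And>b'. b' \<in> B \<Longrightarrow> u \<bullet> b \<le> u \<bullet> b'"
    using continuous_attains_inf[OF assms(1,2)] by blast
  have "a + b \<in> C + B" using assms(5) a(1) b(1) by (auto intro: set_plus_intro)
  then obtain c b' where "c \<in> C" "b' \<in> B" "a + b = c + b'" by (auto elim: set_plus_elim)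
  then have "u \<bullet> a + u \<bullet> b = u \<bullet> c + u \<bullet> b'" by (simp flip: inner_add_right)
  then show False using u(1) u(2)[OF \<open>c \<in> C\<close>] b(2)[OF \<open>b' \<in> B\<close>] by linarith
qed

context
  fixes K :: "'a::euclidean_space set"
  assumes body: "convex_body K"
begin

lemma body_compact: "compact K" and body_convex: "convex K" and body_nonempty: "K \<noteq> {}"
  using body by (auto simp: convex_body_def)

lemma compact_homothet: "compact (homothet K p)"
proof (cases p)
  case (Pair x r)
  show ?thesis
  proof (cases "0 \<le> r")
    case True
    then show ?thesis unfolding Pair homothet_eq_image[OF True]
      by (intro compact_translation compact_scaling body_compact)
  next
    case False
    then have "homothet K p = {}" using homothet_nonempty_imp[of _ K p] Pair by auto
    then show ?thesis by simp
  qed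
qed

lemma convex_homothet: "convex (homothet K p)"
proof (cases p)
  case (Pair x r)
  show ?thesis
  proof (cases "0 \<le> r")
    case True
    then show ?thesis unfolding Pair homothet_eq_image[OF True]
      by (intro convex_translation convex_scaling body_convex)
  next
    case False
    then have "homothet K p = {}" using homothet_nonempty_imp[of _ K p] Pair by auto
    then show ?thesis by simp
  qed
qed

lemma homothet_nonempty: "0 \<le> snd p \<Longrightarrow> homothet K p \<noteq> {}"
  using body_nonempty by (cases p) (simp add: homothet_eq_image)

lemma homothet_add: "0 \<le> snd p \<Longrightarrow> 0 \<le> snd q \<Longrightarrow> homothet K (p + q) = homothet K p + homothet K q"
proof (cases p, cases q)
  fix x r y s assume pq: "p = (x, r)" "q = (y, s)" and "0 \<le> snd p" "0 \<le> snd q"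
  then have rs: "0 \<le> r" "0 \<le> s" by auto
  show "homothet K (p + q) = homothet K p + homothet K q"
  proof
    show "homothet K p + homothet K q \<subseteq> homothet K (p + q)"
    proof
      fix z assume "z \<in> homothet K p + homothet K q"
      then obtain a b where ab: "z = a + b" "(a, 0) + p \<in> cone_over K" "(b, 0) + q \<in> cone_over K"
        by (auto simp: homothet_def elim!: set_plus_elim)
      have "((a, 0) + p) + ((b, 0) + q) = (z, 0) + (p + q)" by (simp add: ab(1) prod_eq_iff)
      then show "z \<in> homothet K (p + q)"
        unfolding homothet_def mem_Collect_eq using cone_over_add[OF body_convex ab(2,3)] by metis
    qed
    show "homothet K (p + q) \<subseteq> homothet K p + homothet K q"
    proof
      fix z assume "z \<in> homothet K (p + q)"
      then obtain k where k: "k \<in> K" "z = - (x + y) + (r + s) *\<^sub>R k"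
        using rs homothet_eq_image[of "r + s" K "x + y"] pq by auto
      have "z = (- x + r *\<^sub>R k) + (- y + s *\<^sub>R k)" by (simp add: k(2) algebra_simps)
      moreover have "- x + r *\<^sub>R k \<in> homothet K p" "- y + s *\<^sub>R k \<in> homothet K q"
        using rs k(1) by (auto simp: pq homothet_eq_image)
      ultimately show "z \<in> homothet K p + homothet K q" by (auto intro: set_plus_intro)
    qed
  qed
qed

lemma homothet_height_zero: "homothet K (x, 0) = {- x}"
  using body_nonempty by (auto simp: homothet_eq_image)

text \<open>
  Otherwise cancelling \<open>snd q\<close> copies of \<open>K\<close> would put a homothet of positive height inside a single
  point, although \<open>K\<close> has interior points.
\<close>

lemma homothet_subset_imp_snd_le:
  assumes "0 \<le> snd p" "homothet K p \<subseteq> homothet K q"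
  shows "snd p \<le> snd q"
proof (rule ccontr)
  assume less: "\<not> snd p \<le> snd q"
  obtain x r y s where pq: "p = (x, r)" "q = (y, s)" by (cases p, cases q)
  have s: "0 \<le> s" "s < r"
    using homothet_nonempty[OF assms(1)] assms(2) homothet_nonempty_imp[of _ K q] less
    by (auto simp: pq)
  have "homothet K p = homothet K (x, r - s) + homothet K (0, s)"
    "homothet K q = homothet K (y, 0) + homothet K (0, s)"
    using s by (simp_all add: pq flip: homothet_add)
  then have "homothet K (x, r - s) + homothet K (0, s) \<subseteq> homothet K (y, 0) + homothet K (0, s)"
    using assms(2) by (simp only:)
  then have "homothet K (x, r - s) \<subseteq> homothet K (y, 0)"
    using s by - (rule minkowski_cancel[OF compact_homothet homothet_nonempty[of "(0, s)"]
        compact_imp_closed[OF compact_homothet] convex_homothet], simp_all)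
  then have *: "- x + (r - s) *\<^sub>R k = - y" if "k \<in> K" for k
    using s that by (auto simp: homothet_height_zero homothet_eq_image)
  obtain k where k: "k \<in> K" using body_nonempty by auto
  have "K \<subseteq> {k}"
  proof
    fix k' assume "k' \<in> K"
    then have "(r - s) *\<^sub>R k' = (r - s) *\<^sub>R k" using *[of k'] *[OF k] by (metis add_left_cancel)
    then show "k' \<in> {k}" using s by simp
  qed
  then have "interior K = {}" using interior_mono[of K "{k}"] by simp
  then show False using body by (simp add: convex_body_def)
qed

text \<open>
  Inclusion of homothets is the order of the cone; cancelling \<open>snd p\<close> copies of \<open>K\<close> reduces the
  inclusion to the membership of a single point.
\<close>

lemma homothet_subset_iff:
  assumes "0 \<le> snd p"
  shows "homothet K p \<subseteq> homothet K q \<longleftrightarrow> q - p \<in> cone_over K"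
proof
  assume sub: "homothet K p \<subseteq> homothet K q"
  obtain x r y s where pq: "p = (x, r)" "q = (y, s)" by (cases p, cases q)
  have r: "0 \<le> r" "r \<le> s" using homothet_subset_imp_snd_le[OF assms sub] assms by (auto simp: pq)
  have "homothet K p = homothet K (x, 0) + homothet K (0, r)"
    "homothet K q = homothet K (y, s - r) + homothet K (0, r)"
    using r by (simp_all add: pq flip: homothet_add)
  then have "homothet K (x, 0) + homothet K (0, r) \<subseteq> homothet K (y, s - r) + homothet K (0, r)"
    using sub by (simp only:)
  then have "homothet K (x, 0) \<subseteq> homothet K (y, s - r)"
    using r by - (rule minkowski_cancel[OF compact_homothet homothet_nonempty[of "(0, r)"]
        compact_imp_closed[OF compact_homothet] convex_homothet], simp_all)
  then have "- x \<in> homothet K (y, s - r)" by (simp add: homothet_height_zero)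
  then show "q - p \<in> cone_over K" by (simp add: homothet_def pq)
next
  assume C: "q - p \<in> cone_over K"
  show "homothet K p \<subseteq> homothet K q"
  proof
    fix y assume "y \<in> homothet K p"
    then have "((y, 0) + p) + (q - p) \<in> cone_over K"
      unfolding homothet_def by (intro cone_over_add[OF body_convex _ C]) simp
    then show "y \<in> homothet K q" by (simp add: homothet_def algebra_simps)
  qed
qed

text \<open>
  The height is a continuous function, and the points of bounded height whose homothets contain \<open>L\<close>
  form a compact set: closed because \<open>C\<close> is closed, bounded because a single point of \<open>L\<close> already
  confines the centre.
\<close>

lemma circumscribing_factor_attained:
  assumes L: "L \<noteq> {}" "bounded L"
  obtains p where "L \<subseteq> homothet K p" "circumscribing_factor K L = ereal (snd p)"
proof -
  obtain c e where c: "0 < e" "ball c e \<subseteq> K"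
    using body unfolding convex_body_def by (meson ex_in_conv mem_interior)
  obtain b where b: "0 < b" "\<And>y. y \<in> L \<Longrightarrow> norm y < b"
    using L(2) by (meson bounded_pos_less)
  \<comment> \<open>Blowing up the ball in \<open>K\<close> by the factor \<open>b / e\<close> gives a ball of radius \<open>b\<close>, which covers \<open>L\<close>
    once its centre is moved to the origin.\<close>
  define R where "R = b / e"
  have R: "0 < R" using b c by (simp add: R_def)
  have "L \<subseteq> homothet K (R *\<^sub>R c, R)"
  proof
    fix y assume "y \<in> L"
    then have "norm (y /\<^sub>R R) < e" using b c R by (simp add: R_def field_simps)
    then have "c + y /\<^sub>R R \<in> K" using c(2) by (auto simp: dist_norm)
    then have "- (R *\<^sub>R c) + R *\<^sub>R (c + y /\<^sub>R R) \<in> homothet K (R *\<^sub>R c, R)"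
      using R by (auto simp: homothet_eq_image)
    then show "y \<in> homothet K (R *\<^sub>R c, R)" using R by (simp add: scaleR_right_distrib)
  qed
  define F where "F = {p. L \<subseteq> homothet K p \<and> snd p \<le> R}"
  have F0: "(R *\<^sub>R c, R) \<in> F" using \<open>L \<subseteq> _\<close> by (simp add: F_def)
  have "closed (cone_over K)"
    unfolding cone_over_def
    by (intro closed_conic_hull disjI2 conjI compact_Times body_compact) (auto simp: zero_prod_def)
  then have "closed ((\<lambda>p. (y, 0) + p) -` cone_over K)" for y :: 'a
    by (intro closed_vimage continuous_intros)
  then have "closed ((\<Inter>y\<in>L. (\<lambda>p. (y, 0) + p) -` cone_over K) \<inter> {p. snd p \<le> R})"
    by (intro closed_Int closed_INT ballI closed_Collect_le continuous_intros) auto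
  also have "((\<Inter>y\<in>L. (\<lambda>p. (y, 0) + p) -` cone_over K) \<inter> {p. snd p \<le> R}) = F"
    by (auto simp: F_def homothet_def)
  finally have "closed F" .
  obtain y where y: "y \<in> L" using L(1) by auto
  let ?f = "\<lambda>(r, k). (- y + r *\<^sub>R k, r)"
  have "compact (?f ` ({0..R} \<times> K))"
    by (intro compact_continuous_image compact_Times body_compact compact_Icc)
      (auto simp: case_prod_unfold intro!: continuous_intros)
  then have "compact (?f ` ({0..R} \<times> K) \<inter> F)" using \<open>closed F\<close> by (rule compact_Int_closed)
  moreover have "F \<subseteq> ?f ` ({0..R} \<times> K)"
  proof
    fix p assume "p \<in> F"
    obtain x r where p: "p = (x, r)" by (cases p)
    have "y \<in> homothet K (x, r)" using \<open>p \<in> F\<close> y by (auto simp: F_def p)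
    then obtain k where k: "0 \<le> r" "k \<in> K" "y + x = r *\<^sub>R k"
      by (auto simp: homothet_def mem_cone_over)
    have "x = - y + r *\<^sub>R k" using k(3) by (simp flip: k(3))
    then have "p = ?f (r, k)" by (simp add: p)
    moreover have "r \<le> R" using \<open>p \<in> F\<close> by (simp add: F_def p)
    ultimately show "p \<in> ?f ` ({0..R} \<times> K)" using k by (intro image_eqI[of _ _ "(r, k)"]) auto
  qed
  ultimately have "compact F" by (simp only: inf.absorb2)
  moreover have "continuous_on F snd" by (intro continuous_intros)
  ultimately obtain p where p: "p \<in> F" "\<And>q. q \<in> F \<Longrightarrow> snd p \<le> snd q"
    using continuous_attains_inf[of F snd] F0 by blast
  have sub: "L \<subseteq> homothet K p" using p(1) by (simp add: F_def)
  have "snd p \<le> snd q" if "L \<subseteq> homothet K q" for q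
    using p(2)[of q] p(2)[OF F0] that by (cases "snd q \<le> R") (auto simp: F_def)
  then have "circumscribing_factor K L = ereal (snd p)"
    by (intro antisym circumscribing_factor_le[OF L(1) sub])
      (auto simp: circumscribing_factor_eq[OF L(1)] intro!: Inf_greatest)
  then show ?thesis using that sub by blast
qed

lemma circumscribing_factor_homothet:
  assumes "0 \<le> snd p"
  shows "circumscribing_factor K (homothet K p) = ereal (snd p)"
proof -
  obtain q where q: "homothet K p \<subseteq> homothet K q"
    "circumscribing_factor K (homothet K p) = ereal (snd q)"
    using circumscribing_factor_attained[OF homothet_nonempty[OF assms]
        compact_imp_bounded[OF compact_homothet]] .
  have "snd p \<le> snd q" using homothet_subset_imp_snd_le[OF assms q(1)] .
  moreover have "circumscribing_factor K (homothet K p) \<le> ereal (snd p)"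
    by (rule circumscribing_factor_le[OF homothet_nonempty[OF assms] order.refl])
  ultimately show ?thesis using q(2) by simp
qed

end

section \<open>Outer additive bodies\<close>

text \<open>
  Split \<open>c = s c + t c\<close> in the sum of \<open>s a + t b\<close> and \<open>c \<in> A \<inter> B\<close>, and regroup: \<open>s a + t c\<close> lies in
  \<open>A\<close> and \<open>s c + t b\<close> lies in \<open>B\<close>.
\<close>

lemma convex_hull_Un_plus_Int_subset:
  fixes A B :: "'a::euclidean_space set"
  assumes "convex A" "convex B"
  shows "convex hull (A \<union> B) + A \<inter> B \<subseteq> A + B"
proof
  fix z assume "z \<in> convex hull (A \<union> B) + A \<inter> B"
  then obtain w c where z: "z = w + c" "w \<in> convex hull (A \<union> B)" "c \<in> A" "c \<in> B"
    by (auto elim: set_plus_elim)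
  show "z \<in> A + B"
  proof (cases "A = {} \<or> B = {}")
    case False
    then obtain a b s t where w: "a \<in> A" "b \<in> B" "0 \<le> s" "0 \<le> t" "s + t = 1"
        "w = s *\<^sub>R a + t *\<^sub>R b"
      using z(2) convex_hull_union_two[of A B] assms by auto
    have "s *\<^sub>R c + t *\<^sub>R c = c" using w(5) by (simp flip: scaleR_left_distrib)
    then have "z = (s *\<^sub>R a + t *\<^sub>R c) + (s *\<^sub>R c + t *\<^sub>R b)"
      unfolding z(1) w(6) by (simp add: algebra_simps)
    moreover have "s *\<^sub>R a + t *\<^sub>R c \<in> A" "s *\<^sub>R c + t *\<^sub>R b \<in> B"
      using w(1-5) z(3,4) by (simp_all add: convexD[OF assms(1)] convexD[OF assms(2)])
    ultimately show ?thesis by (simp only: set_plus_intro)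
  qed (use z(3,4) in blast)
qed

context
  fixes K :: "'a::euclidean_space set"
  assumes body: "convex_body K" and additive: "outer_additive K"
begin

text \<open>
  This is the only place where outer additivity enters. It is applied to the pair
  \<open>convex hull (A \<union> B)\<close>, \<open>A \<inter> B\<close> and to the pair \<open>A\<close>, \<open>B\<close>, where \<open>A\<close> and \<open>B\<close> are the homothets of \<open>p\<close>
  and \<open>q\<close>. The conclusion is that \<open>A \<union> B\<close> fits into a homothet no higher than \<open>B\<close>, which can only
  be \<open>B\<close> itself.
\<close>

lemma minimal_homothet_least:
  assumes L: "L \<noteq> {}" "L \<subseteq> homothet K p" "circumscribing_factor K L = ereal (snd p)"
    and q: "L \<subseteq> homothet K q"
  shows "homothet K p \<subseteq> homothet K q"
proof -
  let ?A = "homothet K p" and ?B = "homothet K q"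
  let ?cf = "circumscribing_factor K"
  have ht: "0 \<le> snd p" "0 \<le> snd q"
    using L(1,2) q homothet_nonempty_imp[of _ K] by blast+
  have ne: "?A \<noteq> {}" "?B \<noteq> {}" "?A \<inter> ?B \<noteq> {}" using L(1,2) q by auto
  note [simp] = compact_homothet[OF body] convex_homothet[OF body]
  let ?U = "convex hull (?A \<union> ?B)"
  have cU: "compact ?U" by (intro compact_convex_hull compact_Un) auto
  have neU: "?U \<noteq> {}" using ne by simp
  have "?cf ?U + ereal (snd p) \<le> ?cf ?U + ?cf (?A \<inter> ?B)"
    using L(2,3) q by (intro add_left_mono) (metis Int_greatest circumscribing_factor_mono)
  also have "\<dots> = ?cf (?U + ?A \<inter> ?B)"
    using additive ne neU cU unfolding outer_additive_def
    by (metis compact_Int compact_homothet[OF body] convex_Int convex_homothet[OF body] convex_convex_hull)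
  also have "\<dots> \<le> ?cf (?A + ?B)"
    by (intro circumscribing_factor_mono convex_hull_Un_plus_Int_subset) auto
  also have "\<dots> = ?cf ?A + ?cf ?B"
    using additive ne unfolding outer_additive_def by simp
  also have "\<dots> = ereal (snd p + snd q)"
    by (simp add: circumscribing_factor_homothet[OF body] ht)
  finally have le: "?cf ?U + ereal (snd p) \<le> ereal (snd p + snd q)" .
  obtain s where s: "?U \<subseteq> homothet K s" "?cf ?U = ereal (snd s)"
    using circumscribing_factor_attained[OF body neU compact_imp_bounded[OF cU]] .
  have "snd s \<le> snd q" using le s(2) by simp
  have AB: "?A \<subseteq> homothet K s" "?B \<subseteq> homothet K s" using s(1) hull_subset[of "?A \<union> ?B" convex] by auto
  have "s - q \<in> cone_over K" using AB(2) homothet_subset_iff[OF body ht(2)] by simp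
  moreover from this have "snd (s - q) = 0"
    using snd_cone_over_nonneg[of "s - q" K] \<open>snd s \<le> snd q\<close> by simp
  ultimately have "s = q" using cone_over_zero_height[of "s - q" K] by simp
  then show ?thesis using AB(1) by simp
qed

text \<open>
  The interpolation property of the order of the cone: between two lower points \<open>a\<close>, \<open>b\<close> and two upper
  points \<open>z\<close>, \<open>w\<close> there is a point \<open>g\<close>. It is obtained as the smallest homothet containing the
  intersection of the homothets of \<open>z\<close> and \<open>w\<close>, which is contained in both of them.
\<close>

lemma homothet_interpolation:
  assumes "z - a \<in> cone_over K" "z - b \<in> cone_over K" "w - a \<in> cone_over K" "w - b \<in> cone_over K"
    and ht: "0 \<le> snd a" "0 \<le> snd b"
  obtains g where "g - a \<in> cone_over K" "g - b \<in> cone_over K" "z - g \<in> cone_over K" "w - g \<in> cone_over K"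
proof -
  let ?L = "homothet K z \<inter> homothet K w"
  have sub: "homothet K a \<subseteq> ?L" "homothet K b \<subseteq> ?L"
    using assms(1-4) homothet_subset_iff[OF body ht(1)] homothet_subset_iff[OF body ht(2)] by blast+
  have ne: "?L \<noteq> {}" using sub(1) homothet_nonempty[OF body ht(1)] by auto
  have "bounded ?L" by (simp add: bounded_Int compact_imp_bounded compact_homothet[OF body])
  then obtain g where g: "?L \<subseteq> homothet K g" "circumscribing_factor K ?L = ereal (snd g)"
    using circumscribing_factor_attained[OF body ne] by blast
  have "0 \<le> snd g" using ne g(1) homothet_nonempty_imp[of _ K g] by blast
  moreover have "homothet K g \<subseteq> homothet K z" "homothet K g \<subseteq> homothet K w"
    by (rule minimal_homothet_least[OF ne g], blast)+
  moreover have "homothet K a \<subseteq> homothet K g" "homothet K b \<subseteq> homothet K g" using sub g(1) by auto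
  ultimately show ?thesis using that by (simp add: homothet_subset_iff[OF body] ht)
qed

end

section \<open>Extreme points of an outer additive body\<close>

text \<open>
  An extreme point of \<open>K\<close> generates an extreme ray of the cone: a decomposition of \<open>a (v, 1)\<close> into two
  points of the cone exhibits \<open>v\<close> as a convex combination of two points of \<open>K\<close>.
\<close>

lemma below_extreme_generator:
  assumes v: "v extreme_point_of K" and p: "p \<in> cone_over K" "a *\<^sub>R (v, 1) - p \<in> cone_over K"
  shows "p = snd p *\<^sub>R (v, 1)"
proof -
  obtain x m where xm: "p = (x, m)" by (cases p)
  obtain k where k: "0 \<le> m" "k \<in> K" "x = m *\<^sub>R k" 
    using p(1) unfolding xm mem_cone_over by blast
  obtain l where l: "m \<le> a" "l \<in> K" "a *\<^sub>R v - x = (a - m) *\<^sub>R l"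
  proof -
    have "(a *\<^sub>R v - x, a - m) \<in> cone_over K" using p(2) by (simp add: xm)
    then show ?thesis using that unfolding mem_cone_over by auto
  qed
  show ?thesis
  proof (cases "m = 0 \<or> m = a")
    case True
    then show ?thesis using k l by (auto simp: xm)
  next
    case False
    then have m: "0 < m" "m < a" using k l by auto
    let ?t = "(a - m) / a"
    have "a *\<^sub>R v = a *\<^sub>R ((1 - ?t) *\<^sub>R k + ?t *\<^sub>R l)"
    proof -
      have "a *\<^sub>R v = m *\<^sub>R k + (a - m) *\<^sub>R l" using l(3) k(3) by (simp add: algebra_simps)
      moreover have "a * (1 - ?t) = m" "a * ?t = a - m" using m by (auto simp: field_simps)
      ultimately show ?thesis by (simp add: scaleR_right_distrib)
    qed
    then have "v = (1 - ?t) *\<^sub>R k + ?t *\<^sub>R l" using m by simp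
    moreover have "0 < ?t" "?t < 1" using m by auto
    ultimately have "k = l" using v k(2) l(2) unfolding extreme_point_of_def in_segment by blast
    then have "v = k" using \<open>v = (1 - ?t) *\<^sub>R k + ?t *\<^sub>R l\<close> by (simp flip: scaleR_left_distrib)
    then show ?thesis by (simp add: xm k(3))
  qed
qed

context
  fixes K :: "'a::euclidean_space set"
  assumes body: "convex_body K" and additive: "outer_additive K"
begin

text \<open>
  The vertices in \<open>S\<close> are removed one by one. If \<open>z = a (v, 1)\<close> lies below \<open>A + B\<close>, where \<open>A\<close> is the
  contribution of one vertex \<open>w\<close>, interpolate \<open>z, B \<le> g \<le> z + B, A + B\<close>. The difference
  \<open>g - B\<close> lies below both \<open>z\<close> and \<open>A\<close>, hence on two different extreme rays, so it vanishes and \<open>z \<le> B\<close>.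
\<close>

lemma extreme_generator_disjoint:
  assumes v: "v extreme_point_of K" and "finite S" "v \<notin> S" "\<And>w. w \<in> S \<Longrightarrow> w extreme_point_of K"
    and "\<And>w. w \<in> S \<Longrightarrow> 0 \<le> b w" "0 \<le> a"
    and "(\<Sum>w\<in>S. b w *\<^sub>R (w, 1)) - a *\<^sub>R (v, 1) \<in> cone_over K"
  shows "a = 0"
  using assms(2-)
proof (induction S)
  case empty
  then show ?case using snd_cone_over_nonneg[of _ K] by force
next
  case (insert w S)
  note cvx = body_convex[OF body]
  let ?A = "b w *\<^sub>R (w, 1::real)" and ?z = "a *\<^sub>R (v, 1::real)"
  define B where "B = (\<Sum>w\<in>S. b w *\<^sub>R (w, 1::real))"
  have inK: "u \<in> K" if "u = v \<or> u \<in> insert w S" for u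
    using that insert.prems(2) v by (auto simp: extreme_point_of_def)
  have A: "?A \<in> cone_over K" using inK insert.prems by (intro cone_over_generator) auto
  have z: "?z \<in> cone_over K" using inK insert.prems by (intro cone_over_generator) auto
  have B: "B \<in> cone_over K" unfolding B_def
    using inK insert.prems by (intro cone_over_sum[OF cvx body_nonempty[OF body]] cone_over_generator) auto
  have zAB: "?A + B - ?z \<in> cone_over K"
    using insert.prems(5) insert.hyps by (simp add: B_def)
  obtain g where g: "g - ?z \<in> cone_over K" "g - B \<in> cone_over K"
      "?z + B - g \<in> cone_over K" "?A + B - g \<in> cone_over K"
    using homothet_interpolation[OF body additive, of "?z + B" ?z B "?A + B"] A z B zAB
      snd_cone_over_nonneg[OF z] snd_cone_over_nonneg[OF B]
    by (metis add_diff_cancel_left' add_diff_cancel_right')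
  define d where "d = g - B"
  have d: "d \<in> cone_over K" "?z - d \<in> cone_over K" "?A - d \<in> cone_over K"
    using g by (simp_all add: d_def algebra_simps)
  have "d = snd d *\<^sub>R (v, 1)" using below_extreme_generator[OF v d(1,2)] .
  moreover have "d = snd d *\<^sub>R (w, 1)"
    using below_extreme_generator[OF _ d(1,3)] insert.prems(2) by simp
  moreover have "v \<noteq> w" using insert.prems(1) by auto
  ultimately have "snd d = 0" by (metis Pair_inject scaleR_Pair scaleR_cancel_left)
  then have "g = B" using cone_over_zero_height[OF d(1)] by (simp add: d_def)
  then show ?case using g(1) insert.prems insert.IH by (simp add: B_def)
qed

text \<open>
  Moving the negative terms of an affine dependence to the other side puts a vertex with positive
  coefficient below a nonnegative combination of the other vertices.
\<close>

lemma extreme_points_affinely_independent: "\<not> affine_dependent {x. x extreme_point_of K}"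
proof
  assume "affine_dependent {x. x extreme_point_of K}"
  then obtain S U where S: "finite S" "\<And>w. w \<in> S \<Longrightarrow> w extreme_point_of K"
    and U: "sum U S = 0" "\<exists>v\<in>S. U v \<noteq> 0" "(\<Sum>v\<in>S. U v *\<^sub>R v) = 0"
    unfolding affine_dependent_explicit by blast
  have "\<exists>v\<in>S. 0 < U v"
  proof (rule ccontr)
    assume "\<not> ?thesis"
    then have "\<forall>v\<in>S. - U v = 0"
      using U(1) S(1) by (subst sum_nonneg_eq_0_iff[symmetric]) (auto simp: sum_negf not_less)
    then show False using U(2) by simp
  qed
  then obtain v where v: "v \<in> S" "0 < U v" by blast
  define N where "N = {w\<in>S. U w < 0}"
  define P where "P = {w\<in>S. 0 \<le> U w \<and> w \<noteq> v}"
  let ?e = "\<lambda>w. U w *\<^sub>R (w, 1::real)"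
  have "(\<Sum>w\<in>S. ?e w) = 0"
    using U by (simp add: prod_eq_iff fst_sum snd_sum)
  moreover have "S = insert v (N \<union> P)" "v \<notin> N \<union> P" "N \<inter> P = {}" "finite N" "finite P"
    using v S(1) by (auto simp: N_def P_def)
  ultimately have "?e v + ((\<Sum>w\<in>N. ?e w) + (\<Sum>w\<in>P. ?e w)) = 0"
    by (simp add: sum.union_disjoint)
  moreover have "(\<Sum>w\<in>N. (- U w) *\<^sub>R (w, 1)) - ?e v
      = (\<Sum>w\<in>P. ?e w) - (?e v + ((\<Sum>w\<in>N. ?e w) + (\<Sum>w\<in>P. ?e w)))"
    by (simp add: sum_negf del: scaleR_Pair)
  ultimately have "(\<Sum>w\<in>N. (- U w) *\<^sub>R (w, 1)) - ?e v = (\<Sum>w\<in>P. ?e w)" by simp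
  moreover have "(\<Sum>w\<in>P. ?e w) \<in> cone_over K"
    using S(2) by (intro cone_over_sum body_convex[OF body] body_nonempty[OF body] cone_over_generator)
      (auto simp: P_def extreme_point_of_def)
  ultimately have "(\<Sum>w\<in>N. (- U w) *\<^sub>R (w, 1)) - U v *\<^sub>R (v, 1) \<in> cone_over K" by simp
  moreover have "finite N" "v \<notin> N" "\<And>w. w \<in> N \<Longrightarrow> w extreme_point_of K" "\<And>w. w \<in> N \<Longrightarrow> 0 \<le> - U w"
    using S v by (auto simp: N_def)
  ultimately have "U v = 0"
    using extreme_generator_disjoint[of v N "\<lambda>w. - U w" "U v"] S(2) v by simp
  then show False using v by simp
qed

lemma outer_additive_imp_simplex: "int DIM('a) simplex K"
proof -
  let ?C = "{x. x extreme_point_of K}"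
  have K: "K = convex hull ?C"
    using body by (intro Krein_Milman_Minkowski) (auto simp: convex_body_def)
  have "aff_dim K = int DIM('a)"
    using body by (intro aff_dim_nonempty_interior) (simp add: convex_body_def)
  moreover have "aff_dim K = aff_dim ?C" by (subst K) (rule aff_dim_convex_hull)
  ultimately have "int (card ?C) = int DIM('a) + 1"
    using aff_dim_affine_independent[OF extreme_points_affinely_independent] by simp
  then show ?thesis
    unfolding simplex_def using K extreme_points_affinely_independent by blast
qed

end

section \<open>Simplices are outer additive\<close>

text \<open>
  Lifting \<open>C\<close> to height 1 turns affine independence into linear independence, so the lifted points
  form a basis of \<open>'a \<times> real\<close> and \<open>\<beta>\<close> is its family of coordinate functionals. On height 1 they
  are the barycentric coordinates, on height 0 their linear parts.
\<close>

lemma barycentric_coordinates: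
  fixes C :: "'a::euclidean_space set"
  assumes C: "\<not> affine_dependent C" "card C = DIM('a) + 1"
  obtains \<beta> :: "'a \<Rightarrow> 'a \<times> real \<Rightarrow> real"
  where "\<And>v. linear (\<beta> v)"
    and "\<And>p. (\<Sum>v\<in>C. \<beta> v p *\<^sub>R (v, 1)) = p"
    and "\<And>t v. v \<in> C \<Longrightarrow> \<beta> v (\<Sum>w\<in>C. t w *\<^sub>R (w, 1)) = t v"
proof -
  define e where "e = (\<lambda>v::'a. (v, 1::real))"
  have fin: "finite C" using C(1) by (rule aff_independent_finite)
  have inj: "inj_on e C" by (auto simp: inj_on_def e_def)
  have ind: "independent (e ` C)"
  proof
    assume "dependent (e ` C)"
    then obtain u where u: "\<exists>v\<in>C. u (e v) \<noteq> 0" "(\<Sum>v\<in>C. u (e v) *\<^sub>R e v) = 0"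
      using fin by (auto simp: dependent_finite sum.reindex[OF inj])
    have "(\<Sum>v\<in>C. u (e v) *\<^sub>R v) = 0" "(\<Sum>v\<in>C. u (e v)) = 0"
      using u(2) by (simp_all add: e_def prod_eq_iff fst_sum snd_sum)
    then have "affine_dependent C"
      using u(1) fin unfolding affine_dependent_explicit_finite[OF fin] by blast
    then show False using C(1) by simp
  qed
  have "card (e ` C) = DIM('a \<times> real)" using C(2) by (simp add: card_image[OF inj])
  then have span: "span (e ` C) = UNIV"
    using ind by (metis card_eq_dim dim_UNIV top.extremum top.extremum_unique finite_imageI fin subset_UNIV)
  define \<beta> where "\<beta> v p = representation (e ` C) p (e v)" for v p
  have lin: "linear (\<beta> v)" for v
    unfolding \<beta>_def
    by (intro linearI) (simp_all add: representation_add[OF ind] representation_scale[OF ind] span)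
  moreover have "(\<Sum>v\<in>C. \<beta> v p *\<^sub>R (v, 1)) = p" for p
  proof -
    have "(\<Sum>b\<in>e ` C. representation (e ` C) p b *\<^sub>R b) = p"
      using fin by (intro sum_representation_eq[OF ind]) (auto simp: span)
    then have "(\<Sum>v\<in>C. \<beta> v p *\<^sub>R e v) = p" by (simp add: sum.reindex[OF inj] \<beta>_def)
    then show ?thesis by (simp add: e_def)
  qed
  moreover have "\<beta> v (\<Sum>w\<in>C. t w *\<^sub>R (w, 1)) = t v" if v: "v \<in> C" for t v
  proof -
    have "\<beta> v (\<Sum>w\<in>C. t w *\<^sub>R (w, 1)) = (\<Sum>w\<in>C. t w * \<beta> v (e w))"
      by (simp add: linear_sum[OF lin] linear_cmul[OF lin] e_def del: scaleR_Pair)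
    also have "\<dots> = (\<Sum>w\<in>C. if w = v then t w else 0)"
      by (intro sum.cong)
        (auto simp: \<beta>_def representation_basis[OF ind] inj_on_eq_iff[OF inj] v)
    finally show ?thesis using v fin by simp
  qed
  ultimately show ?thesis using that by blast
qed

lemma Sup_linear_image_plus:
  fixes g :: "'a::euclidean_space \<Rightarrow> real"
  assumes g: "linear g" and A: "compact A" "A \<noteq> {}" and B: "compact B" "B \<noteq> {}"
  shows "Sup (g ` (A + B)) = Sup (g ` A) + Sup (g ` B)"
proof -
  have cont: "continuous_on S g" for S using g by (simp add: linear_continuous_on linear_linear)
  obtain a where a: "a \<in> A" "\<And>x. x \<in> A \<Longrightarrow> g x \<le> g a"
    using continuous_attains_sup[OF A cont] by auto
  obtain b where b: "b \<in> B" "\<And>x. x \<in> B \<Longrightarrow> g x \<le> g b"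
    using continuous_attains_sup[OF B cont] by auto
  have "Sup (g ` A) = g a" "Sup (g ` B) = g b"
    using a b by (auto intro!: cSup_eq_maximum)
  moreover have "Sup (g ` (A + B)) = g (a + b)"
  proof (rule cSup_eq_maximum)
    show "g (a + b) \<in> g ` (A + B)" using a b by (auto intro: set_plus_intro)
    show "x \<le> g (a + b)" if "x \<in> g ` (A + B)" for x
      using that a(2) b(2) by (auto elim!: set_plus_elim simp: linear_add[OF g] intro!: add_mono)
  qed
  ultimately show ?thesis by (simp add: linear_add[OF g])
qed

lemma linear_uminus_slice:
  fixes f :: "'a::real_vector \<times> real \<Rightarrow> real"
  assumes "linear f"
  shows "linear (\<lambda>y. - f (y, 0))"
proof (rule linearI)
  show "- f (x + y, 0) = - f (x, 0) + - f (y, 0)" for x y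
    using linear_add[OF assms, of "(x, 0)" "(y, 0)"] by simp
  show "- f (c *\<^sub>R x, 0) = c *\<^sub>R - f (x, 0)" for c x
    using linear_cmul[OF assms, of c "(x, 0)"] by simp
qed

text \<open>
  In the coordinates \<open>\<beta>\<close> the cone over the simplex is the positive orthant. So the homothets that
  contain \<open>L\<close> are those with \<open>\<beta> v p \<ge> h v\<close> for all vertices \<open>v\<close>, where \<open>h v\<close> is the maximum of
  \<open>- \<beta> v\<close> on \<open>L\<close>. Since height is the sum of the coordinates, it is smallest when all these
  inequalities are equalities.
\<close>

lemma circumscribing_factor_simplex:
  fixes C :: "'a::euclidean_space set" and \<beta> :: "'a \<Rightarrow> 'a \<times> real \<Rightarrow> real"
  assumes fin: "finite C"
    and lin: "\<And>v. linear (\<beta> v)"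
    and sum_\<beta>: "\<And>p. (\<Sum>v\<in>C. \<beta> v p *\<^sub>R (v, 1)) = p"
    and \<beta>_sum: "\<And>t v. v \<in> C \<Longrightarrow> \<beta> v (\<Sum>w\<in>C. t w *\<^sub>R (w, 1)) = t v"
    and L: "compact L" "L \<noteq> {}"
  shows "circumscribing_factor (convex hull C) L = ereal (\<Sum>v\<in>C. Sup ((\<lambda>y. - \<beta> v (y, 0)) ` L))"
proof -
  define h where "h v = Sup ((\<lambda>y. - \<beta> v (y, 0)) ` L)" for v
  have C0: "C \<noteq> {}"
  proof
    assume "C = {}"
    then show False using sum_\<beta>[of "(0, 1)"] by (simp add: zero_prod_def)
  qed
  have snd_eq: "snd p = (\<Sum>v\<in>C. \<beta> v p)" for p
    using arg_cong[OF sum_\<beta>[of p], of snd] by (simp add: snd_sum)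
  have cone: "p \<in> cone_over (convex hull C) \<longleftrightarrow> (\<forall>v\<in>C. 0 \<le> \<beta> v p)" for p
  proof
    assume "p \<in> cone_over (convex hull C)"
    then obtain r x where p: "0 \<le> r" "x \<in> convex hull C" "p = (r *\<^sub>R x, r)"
      by (cases p) (auto simp: mem_cone_over)
    then obtain u where u: "\<forall>v\<in>C. 0 \<le> u v" "sum u C = 1" "(\<Sum>v\<in>C. u v *\<^sub>R v) = x"
      by (auto simp: convex_hull_finite[OF fin])
    have "p = (\<Sum>v\<in>C. (r * u v) *\<^sub>R (v, 1))"
      using u p by (simp add: prod_eq_iff fst_sum snd_sum scaleR_sum_right[symmetric] sum_distrib_left[symmetric] flip: scaleR_scaleR)
    then show "\<forall>v\<in>C. 0 \<le> \<beta> v p" using \<beta>_sum[of _ "\<lambda>v. r * u v"] u(1) p(1) by simp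
  next
    assume nn: "\<forall>v\<in>C. 0 \<le> \<beta> v p"
    have "(\<Sum>v\<in>C. \<beta> v p *\<^sub>R (v, 1)) \<in> cone_over (convex hull C)"
      using nn C0 by (intro cone_over_sum convex_convex_hull cone_over_generator) (auto intro: hull_inc)
    then show "p \<in> cone_over (convex hull C)" by (simp only: sum_\<beta>)
  qed
  have bdd: "bdd_above ((\<lambda>y. - \<beta> v (y, 0)) ` L)" for v
  proof -
    have "continuous_on L (\<lambda>y. - \<beta> v (y, 0))"
      using linear_uminus_slice[OF lin] by (simp add: linear_continuous_on linear_linear)
    then show ?thesis
      by (rule bounded_imp_bdd_above[OF compact_imp_bounded[OF compact_continuous_image[OF _ L(1)]]])
  qed
  have iff: "L \<subseteq> homothet (convex hull C) p \<longleftrightarrow> (\<forall>v\<in>C. h v \<le> \<beta> v p)" for p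
  proof -
    have "h v \<le> \<beta> v p \<longleftrightarrow> (\<forall>y\<in>L. 0 \<le> \<beta> v ((y, 0) + p))" for v
      unfolding h_def using L(2) bdd[of v]
      by (subst cSup_le_iff) (auto simp: linear_add[OF lin] algebra_simps)
    then show ?thesis by (auto simp: homothet_def cone)
  qed
  define p where "p = (\<Sum>v\<in>C. h v *\<^sub>R (v, 1::real))"
  have \<beta>p: "\<beta> v p = h v" if "v \<in> C" for v unfolding p_def by (rule \<beta>_sum[OF that])
  have sub: "L \<subseteq> homothet (convex hull C) p" by (simp add: iff \<beta>p)
  have "snd p \<le> snd q" if "L \<subseteq> homothet (convex hull C) q" for q
    using that by (auto simp: iff snd_eq \<beta>p intro!: sum_mono)
  then have "circumscribing_factor (convex hull C) L = ereal (snd p)"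
    by (intro antisym circumscribing_factor_le[OF L(2) sub])
      (auto simp: circumscribing_factor_eq[OF L(2)] intro!: Inf_greatest)
  then show ?thesis by (simp add: snd_eq \<beta>p h_def)
qed

lemma simplex_imp_outer_additive:
  fixes K :: "'a::euclidean_space set"
  assumes "int DIM('a) simplex K"
  shows "outer_additive K"
proof -
  obtain C where C: "\<not> affine_dependent C" "card C = DIM('a) + 1" "K = convex hull C"
    using assms by (auto simp: simplex_def)
  obtain \<beta> :: "'a \<Rightarrow> 'a \<times> real \<Rightarrow> real" where lin: "\<And>v. linear (\<beta> v)"
    and \<beta>: "\<And>p. (\<Sum>v\<in>C. \<beta> v p *\<^sub>R (v, 1)) = p"
      "\<And>t v. v \<in> C \<Longrightarrow> \<beta> v (\<Sum>w\<in>C. t w *\<^sub>R (w, 1)) = t v"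
    by (rule barycentric_coordinates[OF C(1,2)]) (rule that)
  have cf: "circumscribing_factor K L = ereal (\<Sum>v\<in>C. Sup ((\<lambda>y. - \<beta> v (y, 0)) ` L))"
    if "compact L" "L \<noteq> {}" for L
    unfolding C(3)
    by (rule circumscribing_factor_simplex[OF aff_independent_finite[OF C(1)] lin \<beta> that])
  show ?thesis
    unfolding outer_additive_def
  proof (intro allI impI, elim conjE)
    fix A B :: "'a set"
    assume A: "A \<noteq> {}" "compact A" and B: "B \<noteq> {}" "compact B"
    have "A + B = {x + y |x y. x \<in> A \<and> y \<in> B}" unfolding set_plus_def by blast
    then have AB: "compact (A + B)" "A + B \<noteq> {}" using compact_sums[OF A(2) B(2)] A(1) B(1) by auto
    show "circumscribing_factor K (A + B) = circumscribing_factor K A + circumscribing_factor K B"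
      unfolding cf[OF A(2,1)] cf[OF B(2,1)] cf[OF AB]
      by (simp add: Sup_linear_image_plus[OF linear_uminus_slice[OF lin] A(2,1) B(2,1)] sum.distrib)
  qed
qed

theorem theorem6:
  fixes K :: "(real ^ 'n) set"
  assumes "convex_body K"
  shows "outer_additive K \<longleftrightarrow> int CARD('n) simplex K"
  using outer_additive_imp_simplex[OF assms] simplex_imp_outer_additive[of K] by auto

end
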